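(* The tableau calculus of HPL is sound for the class of product frames: for every HPL formula $\varphi$, if $\vdash \varphi$, then $\models \varphi$.
   Context: **Language.** Fix a countable set $\mathbf{Prop}$ of propositional variables and two disjoint countably infinite sets $\mathbf{Nom}_1$, $\mathbf{Nom}_2$ of nominals, disjoint from $\mathbf{Prop}$; $\mathbf{Nom}=\mathbf{Nom}_1\cup\mathbf{Nom}_2$. Letters $i,j,k$ range over $\mathbf{Nom}_1$ and $a,b,c$ over $\mathbf{Nom}_2$. HPL formulas: $\varphi ::= p \mid i \mid a \mid \neg\varphi \mid \varphi\land\varphi \mid \diamondsuit_1\varphi \mid \diamondsuit_2\varphi \mid @_i\varphi \mid @_a\varphi$ with $p\in\mathbf{Prop}$. **Semantics.** A Kripke frame is $(W,R)$ with $W$ a non-empty countable set and $R\subseteq W\times W$. Given Kripke frames $(W_1,R_1)$, $(W_2,R_2)$, the product frame is $(W,R_h,R_v)$ with $W=W_1\times W_2$; $(x,y)R_h(x',y')$ iff $xR_1x'$ and $y=y'$; $(x,y)R_v(x',y')$ iff $x=x'$ and $yR_2y'$. A product model $\mathfrak M=(\mathfrak F,V)$ is a product frame $\mathfrak F$ with $V:\mathbf{Prop}\cup\mathbf{Nom}\to\mathcal P(W)$ such that $V(i)=\{x\}\times W_2$ for some $x\in W_1$ (this $x$ is denoted $i^V$) and $V(a)=W_1\times\{y\}$ for some $y\in W_2$ (denoted $a^V$). Satisfaction: $\mathfrak M,(x,y)\models p$ iff $(x,y)\in V(p)$; $\models i$ iff $x=i^V$; $\models a$ iff $y=a^V$;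 $\neg,\land$ as usual; $\models\diamondsuit_1\varphi$ (resp. $\diamondsuit_2\varphi$) iff $\varphi$ holds at some $R_h$-successor (resp. $R_v$-successor) of $(x,y)$; $\mathfrak M,(x,y)\models @_i\varphi$ iff $\mathfrak M,(i^V,y)\models\varphi$; $\mathfrak M,(x,y)\models @_a\varphi$ iff $\mathfrak M,(x,a^V)\models\varphi$. $\models\varphi$ means $\varphi$ holds at every point of every product model. **Tableau.** A tableau is a well-founded tree (each node is reached from the root in finitely many steps; branches may be infinite) constructed as follows. Start with a root formula of the form $@_i@_a\neg\varphi$, where $i,a$ do not occur in $\varphi$. Extend each branch by applying the rules below to all nodes as often as possible; no formula can be added to a branch any more if every new formula generated by applying an arbitrary rule already exists in the branch, or if the branch is closed. A branch is a maximal path; $\varphi\in\Theta$ means $\varphi$ occurs in the branch $\Theta$. Rules (premises / formulas added to the branch; "$\mid$" means the branch splits): - $[\neg\neg]$: $@_i@_a\neg\neg\varphi\ /\ @_i@_a\varphi$. - $[\land]$: $@_i@_a(\varphi\land\psi)\ /\ @_i@_a\varphi,\ @_i@_a\psi$. - $[\neg\land]$: $@_i@_a\neg(\varphi\land\psi)\ /\ @_i@_a\neg\varphi\mid @_i@_a\neg\psi$. - $[\diamondsuit_1]$: $@_i@_a\diamondsuit_1\varphi\ /\ @_i\diamondsuit_1 j,\ @_j@_a\varphi$, where $j\in\mathbf{Nom}_1$ does not occur in the branch; applied only once per formula. - $[\diamondsuit_2]$: $@_i@_a\diamondsuit_2\varphi\ /\ @_a\diamondsuit_2 b,\ @_i@_b\varphi$,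 where $b\in\mathbf{Nom}_2$ does not occur in the branch; applied only once per formula. - $[\neg\diamondsuit_1]$: $@_i@_a\neg\diamondsuit_1\varphi,\ @_i\diamondsuit_1 j\ /\ @_j@_a\neg\varphi$. - $[\neg\diamondsuit_2]$: $@_i@_a\neg\diamondsuit_2\varphi,\ @_a\diamondsuit_2 b\ /\ @_i@_b\neg\varphi$. - $[@_1]$: $@_i@_a@_j\varphi\ /\ @_j@_a\varphi$. $[@_2]$: $@_i@_a@_b\varphi\ /\ @_i@_b\varphi$. - $[\neg@_1]$: $@_i@_a\neg@_j\varphi\ /\ @_j@_a\neg\varphi$. $[\neg@_2]$: $@_i@_a\neg@_b\varphi\ /\ @_i@_b\neg\varphi$. - $[Red_1]$: $@_i@_as\ /\ @_is$. $[Red_2]$: $@_i@_at\ /\ @_at$. - $[\neg_1]$: $@_i\neg j\ /\ @_jj$. $[\neg_2]$: $@_a\neg b\ /\ @_bb$. - $[Id_1]$: $@_i@_a\varphi,\ @_ij\ /\ @_j@_a\varphi$. $[Id_2]$: $@_i@_a\varphi,\ @_ab\ /\ @_i@_b\varphi$. - $[Id'_1]$: $@_is,\ @_ij\ /\ @_js$. $[Id'_2]$: $@_at,\ @_ab\ /\ @_bt$. In $Red_1,Id'_1$: $s=k$ or $\neg k$ with $k\in\mathbf{Nom}_1$; in $Red_2,Id'_2$: $t=c$ or $\neg c$ with $c\in\mathbf{Nom}_2$. A branch $\Theta$ is closed if for some $\varphi,i,a$: $@_i@_a\varphi,@_i@_a\neg\varphi\in\Theta$, or $@_i\varphi,@_i\neg\varphi\in\Theta$,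 or $@_a\varphi,@_a\neg\varphi\in\Theta$; otherwise open. A tableau is closed if all its branches are closed. **Provability.** $\vdash\varphi$ iff there is a closed tableau whose root formula is $@_i@_a\neg\varphi$, with $i\in\mathbf{Nom}_1$, $a\in\mathbf{Nom}_2$ not occurring in $\varphi$. *)

theory Defs
  imports "HOL-Library.Countable_Set" "HOL-Library.Infinite_Typeclass" "HOL-Library.Sublist"
begin

text \<open>
  The sets of propositional variables and of the two sorts of nominals are the types
  \<^typ>\<open>'p\<close>, \<^typ>\<open>'i\<close> and \<^typ>\<open>'a\<close>; they are disjoint because they enter formulas through
  different constructors.  \<open>noms1\<close> and \<open>noms2\<close> collect the nominals occurring in a formula,
  as atoms or as indices of a satisfaction operator.
\<close>

datatype (props: 'p, noms1: 'i, noms2: 'a) fm =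
    Prp 'p
  | Nom1 'i
  | Nom2 'a
  | Neg "('p, 'i, 'a) fm"
  | Con "('p, 'i, 'a) fm" "('p, 'i, 'a) fm"
  | Dia1 "('p, 'i, 'a) fm"
  | Dia2 "('p, 'i, 'a) fm"
  | At1 'i "('p, 'i, 'a) fm"
  | At2 'a "('p, 'i, 'a) fm"

abbreviation At12 :: "'i \<Rightarrow> 'a \<Rightarrow> ('p, 'i, 'a) fm \<Rightarrow> ('p, 'i, 'a) fm" where
  "At12 i a \<phi> \<equiv> At1 i (At2 a \<phi>)"

definition kripke_frame :: "'w set \<Rightarrow> ('w \<times> 'w) set \<Rightarrow> bool" where
  "kripke_frame W R \<longleftrightarrow> W \<noteq> {} \<and> countable W \<and> R \<subseteq> W \<times> W"

text \<open>
  The valuation, a function on the disjoint union of propositional variables and nominals,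
  is given by its three restrictions.
\<close>

record ('p, 'i, 'a, 'u, 'v) model =
  W1 :: "'u set"
  R1 :: "('u \<times> 'u) set"
  W2 :: "'v set"
  R2 :: "('v \<times> 'v) set"
  Vprop :: "'p \<Rightarrow> ('u \<times> 'v) set"
  Vnom1 :: "'i \<Rightarrow> ('u \<times> 'v) set"
  Vnom2 :: "'a \<Rightarrow> ('u \<times> 'v) set"

definition worlds :: "('p, 'i, 'a, 'u, 'v) model \<Rightarrow> ('u \<times> 'v) set" where
  "worlds M = W1 M \<times> W2 M"

definition Rh :: "('p, 'i, 'a, 'u, 'v) model \<Rightarrow> (('u \<times> 'v) \<times> ('u \<times> 'v)) set" where
  "Rh M = {((x, y), (x', y')). (x, y) \<in> worlds M \<and> (x', y') \<in> worlds M \<and> (x, x') \<in> R1 M \<and> y = y'}"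

definition Rv :: "('p, 'i, 'a, 'u, 'v) model \<Rightarrow> (('u \<times> 'v) \<times> ('u \<times> 'v)) set" where
  "Rv M = {((x, y), (x', y')). (x, y) \<in> worlds M \<and> (x', y') \<in> worlds M \<and> x = x' \<and> (y, y') \<in> R2 M}"

definition product_model :: "('p, 'i, 'a, 'u, 'v) model \<Rightarrow> bool" where
  "product_model M \<longleftrightarrow>
     kripke_frame (W1 M) (R1 M) \<and> kripke_frame (W2 M) (R2 M) \<and>
     (\<forall>p. Vprop M p \<subseteq> worlds M) \<and>
     (\<forall>i. \<exists>x\<in>W1 M. Vnom1 M i = {x} \<times> W2 M) \<and>
     (\<forall>a. \<exists>y\<in>W2 M. Vnom2 M a = W1 M \<times> {y})"

definition den1 :: "('p, 'i, 'a, 'u, 'v) model \<Rightarrow> 'i \<Rightarrow> 'u" where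
  "den1 M i = (THE x. x \<in> W1 M \<and> Vnom1 M i = {x} \<times> W2 M)"

definition den2 :: "('p, 'i, 'a, 'u, 'v) model \<Rightarrow> 'a \<Rightarrow> 'v" where
  "den2 M a = (THE y. y \<in> W2 M \<and> Vnom2 M a = W1 M \<times> {y})"

primrec sat :: "('p, 'i, 'a, 'u, 'v) model \<Rightarrow> 'u \<times> 'v \<Rightarrow> ('p, 'i, 'a) fm \<Rightarrow> bool" where
  "sat M w (Prp p) \<longleftrightarrow> w \<in> Vprop M p"
| "sat M w (Nom1 i) \<longleftrightarrow> fst w = den1 M i"
| "sat M w (Nom2 a) \<longleftrightarrow> snd w = den2 M a"
| "sat M w (Neg \<phi>) \<longleftrightarrow> \<not> sat M w \<phi>"
| "sat M w (Con \<phi> \<psi>) \<longleftrightarrow> sat M w \<phi> \<and> sat M w \<psi>"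
| "sat M w (Dia1 \<phi>) \<longleftrightarrow> (\<exists>w'. (w, w') \<in> Rh M \<and> sat M w' \<phi>)"
| "sat M w (Dia2 \<phi>) \<longleftrightarrow> (\<exists>w'. (w, w') \<in> Rv M \<and> sat M w' \<phi>)"
| "sat M w (At1 i \<phi>) \<longleftrightarrow> sat M (den1 M i, snd w) \<phi>"
| "sat M w (At2 a \<phi>) \<longleftrightarrow> sat M (fst w, den2 M a) \<phi>"

text \<open>
  Validity in all product models whose component frames live on subsets of the types
  \<^typ>\<open>'u\<close> and \<^typ>\<open>'v\<close>.  HOL cannot quantify over types inside a formula, so a validity claim
  is to be read with \<^typ>\<open>'u\<close> and \<^typ>\<open>'v\<close> as universally quantified type variables.
\<close>

definition valid :: "'u itself \<Rightarrow> 'v itself \<Rightarrow> ('p, 'i, 'a) fm \<Rightarrow> bool" where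
  "valid _ _ \<phi> \<longleftrightarrow>
     (\<forall>M :: ('p, 'i, 'a, 'u, 'v) model. product_model M \<longrightarrow> (\<forall>w\<in>worlds M. sat M w \<phi>))"

text \<open>
  \<open>rule P cs\<close>: the formulas in \<open>P\<close> are the premises, and \<open>cs\<close> lists for each resulting branch
  the set of formulas added to it.  The two rules introducing a new nominal are separate.
\<close>

inductive rule :: "('p, 'i, 'a) fm set \<Rightarrow> ('p, 'i, 'a) fm set list \<Rightarrow> bool" where
  NegNeg: "rule {At12 i a (Neg (Neg \<phi>))} [{At12 i a \<phi>}]"
| Con: "rule {At12 i a (Con \<phi> \<psi>)} [{At12 i a \<phi>, At12 i a \<psi>}]"
| NegCon: "rule {At12 i a (Neg (Con \<phi> \<psi>))} [{At12 i a (Neg \<phi>)}, {At12 i a (Neg \<psi>)}]"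
| NegDia1: "rule {At12 i a (Neg (Dia1 \<phi>)), At1 i (Dia1 (Nom1 j))} [{At12 j a (Neg \<phi>)}]"
| NegDia2: "rule {At12 i a (Neg (Dia2 \<phi>)), At2 a (Dia2 (Nom2 b))} [{At12 i b (Neg \<phi>)}]"
| At1: "rule {At12 i a (At1 j \<phi>)} [{At12 j a \<phi>}]"
| At2: "rule {At12 i a (At2 b \<phi>)} [{At12 i b \<phi>}]"
| NegAt1: "rule {At12 i a (Neg (At1 j \<phi>))} [{At12 j a (Neg \<phi>)}]"
| NegAt2: "rule {At12 i a (Neg (At2 b \<phi>))} [{At12 i b (Neg \<phi>)}]"
| Red1: "s \<in> {Nom1 k, Neg (Nom1 k)} \<Longrightarrow> rule {At12 i a s} [{At1 i s}]"
| Red2: "t \<in> {Nom2 c, Neg (Nom2 c)} \<Longrightarrow> rule {At12 i a t} [{At2 a t}]"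
| Neg1: "rule {At1 i (Neg (Nom1 j))} [{At1 j (Nom1 j)}]"
| Neg2: "rule {At2 a (Neg (Nom2 b))} [{At2 b (Nom2 b)}]"
| Id1: "rule {At12 i a \<phi>, At1 i (Nom1 j)} [{At12 j a \<phi>}]"
| Id2: "rule {At12 i a \<phi>, At2 a (Nom2 b)} [{At12 i b \<phi>}]"
| Id1': "s \<in> {Nom1 k, Neg (Nom1 k)} \<Longrightarrow> rule {At1 i s, At1 i (Nom1 j)} [{At1 j s}]"
| Id2': "t \<in> {Nom2 c, Neg (Nom2 c)} \<Longrightarrow> rule {At2 a t, At2 a (Nom2 b)} [{At2 b t}]"

text \<open>\<open>dia_rule \<Theta> \<phi> C\<close>: the premise \<open>\<phi>\<close> yields \<open>C\<close>, the nominal introduced being new to \<open>\<Theta>\<close>.\<close>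

inductive dia_rule ::
  "('p, 'i, 'a) fm set \<Rightarrow> ('p, 'i, 'a) fm \<Rightarrow> ('p, 'i, 'a) fm set \<Rightarrow> bool" where
  Dia1: "j \<notin> (\<Union>\<psi>\<in>\<Theta>. noms1 \<psi>) \<Longrightarrow>
     dia_rule \<Theta> (At12 i a (Dia1 \<phi>)) {At1 i (Dia1 (Nom1 j)), At12 j a \<phi>}"
| Dia2: "b \<notin> (\<Union>\<psi>\<in>\<Theta>. noms2 \<psi>) \<Longrightarrow>
     dia_rule \<Theta> (At12 i a (Dia2 \<phi>)) {At2 a (Dia2 (Nom2 b)), At12 i b \<phi>}"

text \<open>
  One extension of a branch with formulas \<open>\<Theta>\<close>.  The set \<open>D\<close> records the formulas to which a
  diamond rule has already been applied on the branch, and \<open>D'\<close> is its value afterwards; it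
  implements the restriction that these rules are applied only once per formula.
\<close>

inductive extends ::
  "('p, 'i, 'a) fm set \<Rightarrow> ('p, 'i, 'a) fm set \<Rightarrow>
   ('p, 'i, 'a) fm set list \<Rightarrow> ('p, 'i, 'a) fm set \<Rightarrow> bool" where
  "P \<subseteq> \<Theta> \<Longrightarrow> rule P cs \<Longrightarrow> extends \<Theta> D cs D"
| "\<phi> \<in> \<Theta> \<Longrightarrow> \<phi> \<notin> D \<Longrightarrow> dia_rule \<Theta> \<phi> C \<Longrightarrow> extends \<Theta> D [C] (insert \<phi> D)"

definition closed_branch :: "('p, 'i, 'a) fm set \<Rightarrow> bool" where
  "closed_branch \<Theta> \<longleftrightarrow>
     (\<exists>\<phi> i a. At12 i a \<phi> \<in> \<Theta> \<and> At12 i a (Neg \<phi>) \<in> \<Theta>) \<or>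
     (\<exists>\<phi> i. At1 i \<phi> \<in> \<Theta> \<and> At1 i (Neg \<phi>) \<in> \<Theta>) \<or>
     (\<exists>\<phi> a. At2 a \<phi> \<in> \<Theta> \<and> At2 a (Neg \<phi>) \<in> \<Theta>)"

text \<open>
  No rule can contribute anything new: each applicable instance of a rule has all formulas of
  one of its alternatives on the branch, and each diamond formula has been dealt with.
\<close>

definition saturated :: "('p, 'i, 'a) fm set \<Rightarrow> ('p, 'i, 'a) fm set \<Rightarrow> bool" where
  "saturated \<Theta> D \<longleftrightarrow>
     (\<forall>P cs. P \<subseteq> \<Theta> \<and> rule P cs \<longrightarrow> (\<exists>C\<in>set cs. C \<subseteq> \<Theta>)) \<and>
     (\<forall>i a \<phi>. At12 i a (Dia1 \<phi>) \<in> \<Theta> \<longrightarrow> At12 i a (Dia1 \<phi>) \<in> D) \<and>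
     (\<forall>i a \<phi>. At12 i a (Dia2 \<phi>) \<in> \<Theta> \<longrightarrow> At12 i a (Dia2 \<phi>) \<in> D)"

text \<open>
  A node is identified with its position, the finite list of child indices leading to it from
  the root, so every node is finitely many steps away from the root while branches may be
  infinite.  \<open>forms\<close> gives the formulas put on the branch at a node: two formulas which a rule
  adds to the same branch share one node.  \<open>used\<close> gives the formulas to which a diamond rule
  has been applied on the way to the node.
\<close>

record ('p, 'i, 'a) tree =
  nodes :: "nat list set"
  forms :: "nat list \<Rightarrow> ('p, 'i, 'a) fm set"
  used :: "nat list \<Rightarrow> ('p, 'i, 'a) fm set"

definition path :: "nat list \<Rightarrow> nat list set" where
  "path u = {v. prefix v u}"

definition forms_on :: "('p, 'i, 'a) tree \<Rightarrow> nat list set \<Rightarrow> ('p, 'i, 'a) fm set" where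
  "forms_on T B = (\<Union>u\<in>B. forms T u)"

definition used_on :: "('p, 'i, 'a) tree \<Rightarrow> nat list set \<Rightarrow> ('p, 'i, 'a) fm set" where
  "used_on T B = (\<Union>u\<in>B. used T u)"

text \<open>A branch is a maximal path, i.e. a maximal set of pairwise comparable nodes.\<close>

definition branch :: "('p, 'i, 'a) tree \<Rightarrow> nat list set \<Rightarrow> bool" where
  "branch T B \<longleftrightarrow>
     B \<subseteq> nodes T \<and> (\<forall>u\<in>B. \<forall>v\<in>B. prefix u v \<or> prefix v u) \<and>
     (\<forall>u\<in>nodes T. (\<forall>v\<in>B. prefix u v \<or> prefix v u) \<longrightarrow> u \<in> B)"

text \<open>
  The last condition says that the rules are applied as often as possible: a branch, finite or
  infinite, to which no rule is applied any more is closed or saturated.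
\<close>

definition tableau :: "('p, 'i, 'a) fm \<Rightarrow> ('p, 'i, 'a) tree \<Rightarrow> bool" where
  "tableau r T \<longleftrightarrow>
     [] \<in> nodes T \<and> forms T [] = {r} \<and> used T [] = {} \<and>
     (\<forall>u n. u @ [n] \<in> nodes T \<longrightarrow> u \<in> nodes T) \<and>
     (\<forall>u\<in>nodes T.
        (\<exists>n. u @ [n] \<in> nodes T) \<longrightarrow>
          \<not> closed_branch (forms_on T (path u)) \<and>
          \<not> saturated (forms_on T (path u)) (used T u) \<and>
          (\<exists>cs D. extends (forms_on T (path u)) (used T u) cs D \<and>
             (\<forall>n. u @ [n] \<in> nodes T \<longleftrightarrow> n < length cs) \<and>
             (\<forall>n<length cs. forms T (u @ [n]) = cs ! n \<and> used T (u @ [n]) = D))) \<and>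
     (\<forall>B. branch T B \<longrightarrow> closed_branch (forms_on T B) \<or> saturated (forms_on T B) (used_on T B))"

definition closed_tableau :: "('p, 'i, 'a) tree \<Rightarrow> bool" where
  "closed_tableau T \<longleftrightarrow> (\<forall>B. branch T B \<longrightarrow> closed_branch (forms_on T B))"

definition provable :: "('p, 'i, 'a) fm \<Rightarrow> bool" where
  "provable \<phi> \<longleftrightarrow>
     (\<exists>i a T. i \<notin> noms1 \<phi> \<and> a \<notin> noms2 \<phi> \<and>
        tableau (At12 i a (Neg \<phi>)) T \<and> closed_tableau T)"

end

theory Submission
  imports Defs
begin

text \<open>
  Suppose that \<open>\<phi>\<close> fails at a world \<open>(x, y)\<close> of a product model.  The nominals \<open>i\<close> and \<open>a\<close> of the
  root formula do not occur in \<open>\<phi>\<close>, so they can be reinterpreted as names of \<open>x\<close> and \<open>y\<close>, which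
  makes the root formula true.  Satisfiability then propagates down the tableau: whenever the
  formulas on the path to a node have a common model, so do those on the path to one of its
  children (\<open>extends_satisfiable\<close>).  Two points deserve attention.

  First, the formulas on a branch are all prefixed by a satisfaction operator, but some of them,
  such as \<open>At1 i (Dia1 (Nom1 j))\<close>, fix one coordinate only.  The notion of a model of a set of
  formulas used here, \<open>models\<close>, asks for truth at all worlds, which is the right reading of these
  formulas because their truth value does not depend on the coordinate left free.

  Second, a diamond rule forces a change of the model, since it gives a name to the witness of
  the diamond.  The model may thus change infinitely often along an infinite branch, and no single
  model of the whole branch is constructed.  None is needed: a branch is closed because of two
  formulas, and these already occur together on a finite path.  Following satisfiable children
  from the root therefore yields an open branch, so the tableau is not closed
  (\<open>satisfiable_root_not_closed\<close>).
\<close>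

section \<open>Denotations of nominals and product models\<close>

lemma product_modelD:
  assumes "product_model M"
  shows "W1 M \<noteq> {}" "W2 M \<noteq> {}" "R1 M \<subseteq> W1 M \<times> W1 M" "R2 M \<subseteq> W2 M \<times> W2 M"
  using assms by (auto simp: product_model_def kripke_frame_def)

lemma den1_eqI:
  assumes "product_model M" "x \<in> W1 M" "Vnom1 M i = {x} \<times> W2 M"
  shows "den1 M i = x"
  unfolding den1_def
proof (rule the_equality)
  show "x \<in> W1 M \<and> Vnom1 M i = {x} \<times> W2 M" using assms by simp
next
  fix x' assume "x' \<in> W1 M \<and> Vnom1 M i = {x'} \<times> W2 M"
  then have "{x'} \<times> W2 M = {x} \<times> W2 M" using assms by simp
  then show "x' = x" using product_modelD(2)[OF assms(1)] by (auto simp: times_eq_iff)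
qed

lemma den2_eqI:
  assumes "product_model M" "y \<in> W2 M" "Vnom2 M a = W1 M \<times> {y}"
  shows "den2 M a = y"
  unfolding den2_def
proof (rule the_equality)
  show "y \<in> W2 M \<and> Vnom2 M a = W1 M \<times> {y}" using assms by simp
next
  fix y' assume "y' \<in> W2 M \<and> Vnom2 M a = W1 M \<times> {y'}"
  then have "W1 M \<times> {y'} = W1 M \<times> {y}" using assms by simp
  then show "y' = y" using product_modelD(1)[OF assms(1)] by (auto simp: times_eq_iff)
qed

lemma den1_in:
  assumes "product_model M"
  shows "den1 M i \<in> W1 M"
proof -
  obtain x where "x \<in> W1 M" "Vnom1 M i = {x} \<times> W2 M"
    using assms unfolding product_model_def by blast
  then show ?thesis using den1_eqI[OF assms] by metis
qed

lemma den2_in: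
  assumes "product_model M"
  shows "den2 M a \<in> W2 M"
proof -
  obtain y where "y \<in> W2 M" "Vnom2 M a = W1 M \<times> {y}"
    using assms unfolding product_model_def by blast
  then show ?thesis using den2_eqI[OF assms] by metis
qed

lemma sat_Dia1_iff:
  assumes "product_model M" "x \<in> W1 M" "y \<in> W2 M"
  shows "sat M (x, y) (Dia1 \<phi>) \<longleftrightarrow> (\<exists>x'. (x, x') \<in> R1 M \<and> sat M (x', y) \<phi>)"
  using product_modelD(3)[OF assms(1)] assms(2,3) by (auto simp: Rh_def worlds_def)

lemma sat_Dia2_iff:
  assumes "product_model M" "x \<in> W1 M" "y \<in> W2 M"
  shows "sat M (x, y) (Dia2 \<phi>) \<longleftrightarrow> (\<exists>y'. (y, y') \<in> R2 M \<and> sat M (x, y') \<phi>)"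
  using product_modelD(4)[OF assms(1)] assms(2,3) by (auto simp: Rv_def worlds_def)

section \<open>Reinterpreting a nominal\<close>

definition rename1 ::
  "('p, 'i, 'a, 'u, 'v) model \<Rightarrow> 'i \<Rightarrow> 'u \<Rightarrow> ('p, 'i, 'a, 'u, 'v) model" where
  "rename1 M j x = M\<lparr>Vnom1 := (Vnom1 M)(j := {x} \<times> W2 M)\<rparr>"

definition rename2 ::
  "('p, 'i, 'a, 'u, 'v) model \<Rightarrow> 'a \<Rightarrow> 'v \<Rightarrow> ('p, 'i, 'a, 'u, 'v) model" where
  "rename2 M b y = M\<lparr>Vnom2 := (Vnom2 M)(b := W1 M \<times> {y})\<rparr>"

lemma rename1_simps [simp]:
  "W1 (rename1 M j x) = W1 M" "W2 (rename1 M j x) = W2 M"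
  "R1 (rename1 M j x) = R1 M" "R2 (rename1 M j x) = R2 M"
  "worlds (rename1 M j x) = worlds M" "Rh (rename1 M j x) = Rh M" "Rv (rename1 M j x) = Rv M"
  "Vprop (rename1 M j x) = Vprop M" "Vnom2 (rename1 M j x) = Vnom2 M"
  "den2 (rename1 M j x) = den2 M"
  by (auto simp: rename1_def worlds_def Rh_def Rv_def den2_def fun_eq_iff)

lemma rename2_simps [simp]:
  "W1 (rename2 M b y) = W1 M" "W2 (rename2 M b y) = W2 M"
  "R1 (rename2 M b y) = R1 M" "R2 (rename2 M b y) = R2 M"
  "worlds (rename2 M b y) = worlds M" "Rh (rename2 M b y) = Rh M" "Rv (rename2 M b y) = Rv M"
  "Vprop (rename2 M b y) = Vprop M" "Vnom1 (rename2 M b y) = Vnom1 M"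
  "den1 (rename2 M b y) = den1 M"
  by (auto simp: rename2_def worlds_def Rh_def Rv_def den1_def fun_eq_iff)

lemma product_model_rename1:
  assumes "product_model M" "x \<in> W1 M"
  shows "product_model (rename1 M j x)"
  using assms by (auto simp: product_model_def) (auto simp: rename1_def)

lemma product_model_rename2:
  assumes "product_model M" "y \<in> W2 M"
  shows "product_model (rename2 M b y)"
  using assms by (auto simp: product_model_def) (auto simp: rename2_def)

lemma den1_rename1:
  assumes "product_model M" "x \<in> W1 M"
  shows "den1 (rename1 M j x) j = x"
  by (rule den1_eqI[OF product_model_rename1[OF assms]]) (use assms in \<open>auto simp: rename1_def\<close>)

lemma den2_rename2:
  assumes "product_model M" "y \<in> W2 M"
  shows "den2 (rename2 M b y) b = y"
  by (rule den2_eqI[OF product_model_rename2[OF assms]]) (use assms in \<open>auto simp: rename2_def\<close>)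

lemma den1_rename1_other: "i \<noteq> j \<Longrightarrow> den1 (rename1 M j x) i = den1 M i"
  by (simp add: den1_def rename1_def)

lemma den2_rename2_other: "a \<noteq> b \<Longrightarrow> den2 (rename2 M b y) a = den2 M a"
  by (simp add: den2_def rename2_def)

lemma sat_rename1_fresh: "j \<notin> noms1 \<phi> \<Longrightarrow> sat (rename1 M j x) w \<phi> \<longleftrightarrow> sat M w \<phi>"
  by (induction \<phi> arbitrary: w) (auto simp: den1_rename1_other)

lemma sat_rename2_fresh: "b \<notin> noms2 \<phi> \<Longrightarrow> sat (rename2 M b y) w \<phi> \<longleftrightarrow> sat M w \<phi>"
  by (induction \<phi> arbitrary: w) (auto simp: den2_rename2_other)

section \<open>Soundness of the rules\<close>

definition models ::
  "('p, 'i, 'a, 'u, 'v) model \<Rightarrow> ('p, 'i, 'a) fm set \<Rightarrow> bool" where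
  "models M \<Theta> \<longleftrightarrow> product_model M \<and> (\<forall>\<psi>\<in>\<Theta>. \<forall>x\<in>W1 M. \<forall>y\<in>W2 M. sat M (x, y) \<psi>)"

lemma models_Un: "models M (\<Theta> \<union> \<Theta>') \<longleftrightarrow> models M \<Theta> \<and> models M \<Theta>'"
  by (auto simp: models_def)

lemma models_mono: "models M \<Theta> \<Longrightarrow> P \<subseteq> \<Theta> \<Longrightarrow> models M P"
  by (auto simp: models_def)

text \<open>
  Each rule preserves truth at a single world.  The rule with two alternatives needs more, that the
  same alternative is true at all worlds; this holds because the truth value of a formula of the
  form \<open>At12 i a \<phi>\<close> is the same everywhere.
\<close>

lemma rule_sound:
  assumes "rule P cs" "models M P"
  shows "\<exists>C\<in>set cs. models M C"
proof -
  have pm: "product_model M" using assms(2) by (simp add: models_def)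
  note ne = product_modelD(1,2)[OF pm]
  note dia = sat_Dia1_iff[OF pm] sat_Dia2_iff[OF pm]
  show ?thesis using assms
    by cases
      (use pm ne in \<open>auto simp: models_def dia den1_in den2_in simp del: sat.simps(6,7)\<close>)
qed

text \<open>
  The fresh nominal is made a name of the witness of the diamond; this leaves the truth of the
  formulas already on the branch unchanged.  The premise is one of them, so the new name clashes
  neither with the nominals in its prefix nor with those below the diamond.
\<close>

lemma dia_rule_sound:
  fixes M :: "('p, 'i, 'a, 'u, 'v) model"
  assumes "dia_rule \<Theta> \<phi> C" "\<phi> \<in> \<Theta>" "models M \<Theta>"
  shows "\<exists>M' :: ('p, 'i, 'a, 'u, 'v) model. models M' (\<Theta> \<union> C)"
proof -
  have pm: "product_model M" using assms(3) by (simp add: models_def)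
  obtain x0 y0 where w0: "x0 \<in> W1 M" "y0 \<in> W2 M" using product_modelD(1,2)[OF pm] by auto
  then have sat_\<phi>: "sat M (x0, y0) \<phi>" using assms(2,3) by (auto simp: models_def)
  show ?thesis using assms(1)
  proof cases
    case (Dia1 j i a \<psi>)
    have fresh: "j \<notin> noms1 \<chi>" if "\<chi> \<in> \<Theta>" for \<chi> using Dia1 that by auto
    have "j \<noteq> i" "j \<notin> noms1 \<psi>" using fresh[OF assms(2)] Dia1 by auto
    obtain x where x: "(den1 M i, x) \<in> R1 M" "sat M (x, den2 M a) \<psi>"
      using sat_\<phi> Dia1 by (auto simp: sat_Dia1_iff[OF pm] den1_in[OF pm] den2_in[OF pm]
          simp del: sat.simps(6))
    have xW: "x \<in> W1 M" using x product_modelD(3)[OF pm] by auto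
    define M' where "M' = rename1 M j x"
    have pm': "product_model M'" unfolding M'_def by (rule product_model_rename1[OF pm xW])
    have "models M' \<Theta>"
      using assms(3) pm' fresh by (auto simp: models_def M'_def sat_rename1_fresh)
    moreover have "models M' C"
    proof -
      have M': "den1 M' j = x" "den1 M' i = den1 M i" "den2 M' = den2 M" "R1 M' = R1 M"
        using den1_rename1[OF pm xW] \<open>j \<noteq> i\<close> by (simp_all add: M'_def den1_rename1_other)
      have "sat M' (x, den2 M a) \<psi>"
        using x(2) \<open>j \<notin> noms1 \<psi>\<close> by (simp add: M'_def sat_rename1_fresh)
      then show ?thesis
        using x(1) M' Dia1(2) pm' den1_in[OF pm', of i]
        by (auto simp: models_def sat_Dia1_iff[OF pm'] simp del: sat.simps(6))
    qed
    ultimately show ?thesis by (auto simp: models_Un)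
  next
    case (Dia2 b i a \<psi>)
    have fresh: "b \<notin> noms2 \<chi>" if "\<chi> \<in> \<Theta>" for \<chi> using Dia2 that by auto
    have "b \<noteq> a" "b \<notin> noms2 \<psi>" using fresh[OF assms(2)] Dia2 by auto
    obtain y where y: "(den2 M a, y) \<in> R2 M" "sat M (den1 M i, y) \<psi>"
      using sat_\<phi> Dia2 by (auto simp: sat_Dia2_iff[OF pm] den1_in[OF pm] den2_in[OF pm]
          simp del: sat.simps(7))
    have yW: "y \<in> W2 M" using y product_modelD(4)[OF pm] by auto
    define M' where "M' = rename2 M b y"
    have pm': "product_model M'" unfolding M'_def by (rule product_model_rename2[OF pm yW])
    have "models M' \<Theta>"
      using assms(3) pm' fresh by (auto simp: models_def M'_def sat_rename2_fresh)
    moreover have "models M' C"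
    proof -
      have M': "den2 M' b = y" "den2 M' a = den2 M a" "den1 M' = den1 M" "R2 M' = R2 M"
        using den2_rename2[OF pm yW] \<open>b \<noteq> a\<close> by (simp_all add: M'_def den2_rename2_other)
      have "sat M' (den1 M i, y) \<psi>"
        using y(2) \<open>b \<notin> noms2 \<psi>\<close> by (simp add: M'_def sat_rename2_fresh)
      then show ?thesis
        using y(1) M' Dia2(2) pm' den2_in[OF pm', of a]
        by (auto simp: models_def sat_Dia2_iff[OF pm'] simp del: sat.simps(7))
    qed
    ultimately show ?thesis by (auto simp: models_Un)
  qed
qed

lemma extends_satisfiable:
  fixes M :: "('p, 'i, 'a, 'u, 'v) model"
  assumes "extends \<Theta> D cs D'" "models M \<Theta>"
  shows "\<exists>n<length cs. \<exists>M' :: ('p, 'i, 'a, 'u, 'v) model. models M' (\<Theta> \<union> cs ! n)"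
  using assms(1)
proof cases
  case (1 P)
  then obtain C where "C \<in> set cs" "models M C"
    using rule_sound models_mono[OF assms(2)] by blast
  then show ?thesis using assms(2) by (metis in_set_conv_nth models_Un)
next
  case (2 \<phi> C)
  then show ?thesis using dia_rule_sound[OF _ _ assms(2)] by auto
qed

lemma models_not_closed:
  assumes "models M \<Theta>"
  shows "\<not> closed_branch \<Theta>"
proof
  assume "closed_branch \<Theta>"
  moreover have pm: "product_model M" using assms by (simp add: models_def)
  obtain x y where "x \<in> W1 M" "y \<in> W2 M" using product_modelD(1,2)[OF pm] by auto
  then have sat_\<Theta>: "sat M (x, y) \<psi>" if "\<psi> \<in> \<Theta>" for \<psi> using assms that by (auto simp: models_def)
  ultimately show False unfolding closed_branch_def
    by (elim disjE exE conjE) (auto dest!: sat_\<Theta>)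
qed

section \<open>An open branch\<close>

text \<open>Closedness is witnessed by two formulas, hence a finitary property.\<close>

lemma closed_branch_chain:
  fixes F :: "nat \<Rightarrow> ('p, 'i, 'a) fm set"
  assumes "closed_branch (\<Union>n. F n)" "mono F"
  shows "\<exists>n. closed_branch (F n)"
proof -
  have common: "\<exists>n. \<phi> \<in> F n \<and> \<psi> \<in> F n" if "\<phi> \<in> (\<Union>n. F n)" "\<psi> \<in> (\<Union>n. F n)" for \<phi> \<psi>
  proof -
    obtain m n where "\<phi> \<in> F m" "\<psi> \<in> F n" using \<open>\<phi> \<in> _\<close> \<open>\<psi> \<in> _\<close> by blast
    then have "\<phi> \<in> F (max m n) \<and> \<psi> \<in> F (max m n)"
      using monoD[OF assms(2), of m "max m n"] monoD[OF assms(2), of n "max m n"] by auto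
    then show ?thesis ..
  qed
  show ?thesis using assms(1) unfolding closed_branch_def
    by (elim disjE exE conjE) (metis common)+
qed

text \<open>
  A sequence of nodes that steps from each node to one of its children, and stays at a node
  without children, runs through a branch: a node comparable to all members of the sequence but
  prefix of none would lie strictly below all of them, so the sequence would have to come to a
  halt, although the node where it halts has a child.
\<close>

lemma branch_range:
  assumes root: "s 0 = []" "[] \<in> nodes T"
    and down: "\<forall>u n. u @ [n] \<in> nodes T \<longrightarrow> u \<in> nodes T"
    and child: "\<forall>n. (\<exists>k. s n @ [k] \<in> nodes T) \<longrightarrow>
      (\<exists>k. s (Suc n) = s n @ [k] \<and> s n @ [k] \<in> nodes T)"
    and leaf: "\<forall>n. (\<nexists>k. s n @ [k] \<in> nodes T) \<longrightarrow> s (Suc n) = s n"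
  shows "branch T (range s)" and "\<And>m n. m \<le> n \<Longrightarrow> prefix (s m) (s n)"
    and "\<And>n. path (s n) \<subseteq> range s"
proof -
  have succ: "s (Suc n) = s n \<or> (\<exists>k. s (Suc n) = s n @ [k])" for n
    using child leaf by blast
  show pre: "prefix (s m) (s n)" if "m \<le> n" for m n
    using that
  proof (induction rule: dec_induct)
    case (step n)
    have "prefix (s n) (s (Suc n))" using succ[of n] by auto
    with step.IH show ?case by (rule prefix_order.trans)
  qed simp
  have nodes: "s n \<in> nodes T" for n
  proof (induction n)
    case (Suc n)
    then show ?case using child leaf by metis
  qed (simp add: root)
  show paths: "path (s n) \<subseteq> range s" for n
  proof (induction n)
    case 0
    then show ?case using root by (auto simp: path_def intro: range_eqI[of _ _ 0])
  next
    case (Suc n)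
    have "u \<in> range s" if "prefix u (s (Suc n))" for u
    proof (cases "u = s (Suc n)")
      case False
      then have "prefix u (s n)" using succ[of n] that by auto
      then show ?thesis using Suc by (auto simp: path_def)
    qed simp
    then show ?case by (auto simp: path_def)
  qed
  have down': "u \<in> nodes T" if "u @ v \<in> nodes T" for u v
    using that by (induction v rule: rev_induct) (use down in \<open>auto simp flip: append_assoc\<close>)
  have "u \<in> range s" if u: "u \<in> nodes T" and comp: "\<And>n. prefix u (s n) \<or> prefix (s n) u" for u
  proof (rule ccontr)
    assume "u \<notin> range s"
    then have below: "strict_prefix (s n) u" for n
      using comp[of n] paths[of n] by (auto simp: path_def strict_prefix_def)
    \<comment> \<open>All nodes of the sequence have a child now, namely the next node on the way to \<open>u\<close>.\<close>
    have "length (s n) = n" for n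
    proof (induction n)
      case (Suc n)
      obtain k v where "u = s n @ k # v" using below[of n] by (auto elim: strict_prefixE')
      then have "s n @ [k] \<in> nodes T" using down'[of "s n @ [k]" v] u by simp
      then show ?case using spec[OF child, of n] Suc by auto
    qed (simp add: root)
    then show False using below[of "length u"] prefix_length_less by fastforce
  qed
  then show "branch T (range s)"
    unfolding branch_def using nodes pre by (auto, metis nle_le)
qed

lemma satisfiable_root_not_closed:
  fixes M :: "('p, 'i, 'a, 'u, 'v) model"
  assumes T: "tableau r T" and M: "models M {r}"
  shows "\<not> closed_tableau T"
proof
  assume closed: "closed_tableau T"
  define good where "good u \<longleftrightarrow> u \<in> nodes T \<and>
    (\<exists>M :: ('p, 'i, 'a, 'u, 'v) model. models M (forms_on T (path u)))" for u
  have good_root: "good []"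
    using T M by (auto simp: good_def tableau_def forms_on_def path_def)
  have good_child: "\<exists>k. good (u @ [k])" if u: "good u" "\<exists>k. u @ [k] \<in> nodes T" for u
  proof -
    let ?F = "forms_on T (path u)"
    have node: "u \<in> nodes T" using u(1) by (simp add: good_def)
    have ext_all: "\<forall>u\<in>nodes T. (\<exists>n. u @ [n] \<in> nodes T) \<longrightarrow>
        \<not> closed_branch (forms_on T (path u)) \<and>
        \<not> saturated (forms_on T (path u)) (used T u) \<and>
        (\<exists>cs D. extends (forms_on T (path u)) (used T u) cs D \<and>
           (\<forall>n. u @ [n] \<in> nodes T \<longleftrightarrow> n < length cs) \<and>
           (\<forall>n<length cs. forms T (u @ [n]) = cs ! n \<and> used T (u @ [n]) = D))"
      using T unfolding tableau_def by (elim conjE)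
    from mp[OF bspec[OF ext_all node] u(2)] obtain cs D where ext: "extends ?F (used T u) cs D"
      and ch: "\<forall>n. u @ [n] \<in> nodes T \<longleftrightarrow> n < length cs"
      and lab: "\<forall>n<length cs. forms T (u @ [n]) = cs ! n \<and> used T (u @ [n]) = D"
      by (elim exE conjE)
    obtain n M' where n: "n < length cs"
      and M': "models (M' :: ('p, 'i, 'a, 'u, 'v) model) (?F \<union> cs ! n)"
      using extends_satisfiable[OF ext] u(1) unfolding good_def by metis
    have "forms_on T (path (u @ [n])) = ?F \<union> cs ! n"
      using lab n by (auto simp: forms_on_def path_def)
    then show ?thesis using n ch M' unfolding good_def by metis
  qed
  \<comment> \<open>The choice is applied only where a child exists, and there \<open>good_child\<close> provides a good one.\<close>
  define s where "s = rec_nat []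
    (\<lambda>_ u. if \<exists>k. u @ [k] \<in> nodes T then u @ [SOME k. good (u @ [k])] else u)"
  have s0: "s 0 = []" by (simp add: s_def)
  have sSuc: "s (Suc n) =
    (if \<exists>k. s n @ [k] \<in> nodes T then s n @ [SOME k. good (s n @ [k])] else s n)" for n
    by (simp add: s_def)
  have good: "good (s n)" for n
  proof (induction n)
    case (Suc n)
    then show ?case using sSuc[of n] someI_ex[OF good_child[OF Suc]]
      by (cases "\<exists>k. s n @ [k] \<in> nodes T") auto
  qed (simp add: s0 good_root)
  have child: "\<forall>n. (\<exists>k. s n @ [k] \<in> nodes T) \<longrightarrow>
      (\<exists>k. s (Suc n) = s n @ [k] \<and> s n @ [k] \<in> nodes T)"
  proof (intro allI impI)
    fix n assume "\<exists>k. s n @ [k] \<in> nodes T"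
    then show "\<exists>k. s (Suc n) = s n @ [k] \<and> s n @ [k] \<in> nodes T"
      using sSuc[of n] good[of "Suc n"] by (simp add: good_def)
  qed
  have leaf: "\<forall>n. (\<nexists>k. s n @ [k] \<in> nodes T) \<longrightarrow> s (Suc n) = s n"
    using sSuc by simp
  have root: "[] \<in> nodes T" and down: "\<forall>u n. u @ [n] \<in> nodes T \<longrightarrow> u \<in> nodes T"
    using T by (simp_all add: tableau_def)
  note br = branch_range[OF s0 root down child leaf]
  let ?F = "\<lambda>n. forms_on T (path (s n))"
  have "forms_on T (range s) = (\<Union>n. ?F n)"
  proof -
    have "range s = (\<Union>n. path (s n))" using br(3) by (auto simp: path_def)
    then show ?thesis by (simp add: forms_on_def)
  qed
  moreover have "closed_branch (forms_on T (range s))"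
    using closed br(1) unfolding closed_tableau_def by blast
  moreover have "mono ?F"
    using br(2) unfolding mono_def forms_on_def path_def
    by (blast intro: prefix_order.trans)
  ultimately obtain n where "closed_branch (?F n)" using closed_branch_chain[of ?F] by auto
  then show False using good[of n] models_not_closed unfolding good_def by metis
qed

theorem theorem4p5:
  fixes \<phi> :: "('p::countable, 'i::{countable, infinite}, 'a::{countable, infinite}) fm"
  assumes "provable \<phi>"
  shows "valid TYPE('u) TYPE('v) \<phi>"
proof (rule ccontr)
  assume "\<not> valid TYPE('u) TYPE('v) \<phi>"
  then obtain M :: "('p, 'i, 'a, 'u, 'v) model" and x y
    where pm: "product_model M" and x: "x \<in> W1 M" and y: "y \<in> W2 M" and \<phi>: "\<not> sat M (x, y) \<phi>"
    by (auto simp: valid_def worlds_def)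
  obtain i a T where fresh: "i \<notin> noms1 \<phi>" "a \<notin> noms2 \<phi>"
    and T: "tableau (At12 i a (Neg \<phi>)) T" "closed_tableau T"
    using assms unfolding provable_def by blast
  define M1 where "M1 = rename1 M i x"
  have pm1: "product_model M1" and y1: "y \<in> W2 M1"
    using product_model_rename1[OF pm x] y by (simp_all add: M1_def)
  have "models (rename2 M1 a y) {At12 i a (Neg \<phi>)}"
    using product_model_rename2[OF pm1 y1] den2_rename2[OF pm1 y1] den1_rename1[OF pm x] \<phi> fresh
    by (simp add: models_def sat_rename2_fresh) (simp add: M1_def sat_rename1_fresh)
  then show False using satisfiable_root_not_closed T by blast
qed

end
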